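(* Let $\beta:\mathbb{Z}^+\to\mathbb{Z}^+$ be a positive integer function, let $M$ be a matroid of rank $n$ whose girth $g$ satisfies $g\ge n-\beta(n)+1$, and let $\mathcal{B}=(B_1,\dots,B_n)$ be a disjoint base sequence of $M$. If $n\ge 4\beta(n)^2+7\beta(n)+5$, then $t(\mathcal{B})\ge n-4\beta(n)^2-7\beta(n)-4$.
   Context: Matroids are finite. The girth of a matroid is the size of a smallest circuit ($\infty$ if there are no circuits). A base sequence of a rank $n$ matroid $M$ is an $n$-tuple $\mathcal{B}=(B_1,\dots,B_n)$ of bases of $M$; the base $B_i$ is thought of as coloured with colour $i$. It is called disjoint if $B_1,\dots,B_n$ are pairwise disjoint. A rainbow base with respect to $\mathcal{B}$ is a base of $M$ containing exactly one element of each colour; precisely, it is given by a choice of representatives $b_c\in B_c$, $c=1,\dots,n$, that are distinct and such that $\{b_1,\dots,b_n\}$ is a base of $M$. Rainbow bases are said to be disjoint if for each colour $c$ their representatives of colour $c$ are distinct. $t(\mathcal{B})$ denotes the cardinality of a largest set of disjoint rainbow bases with respect to $\mathcal{B}$. *)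

theory Defs
  imports Main "HOL-Library.Extended_Nat" "HOL-Library.FuncSet" "HOL-Library.Disjoint_Sets"
begin

locale matroid =
  fixes E :: "'a set" and indep :: "'a set \<Rightarrow> bool"
  assumes finite_ground: "finite E"
    and indep_subset_ground: "indep X \<Longrightarrow> X \<subseteq> E"
    and indep_empty: "indep {}"
    and indep_mono: "indep Y \<Longrightarrow> X \<subseteq> Y \<Longrightarrow> indep X"
    and augmentation:
      "indep X \<Longrightarrow> indep Y \<Longrightarrow> card X < card Y \<Longrightarrow> \<exists>y \<in> Y - X. indep (insert y X)"
begin

definition base :: "'a set \<Rightarrow> bool" where
  "base B \<longleftrightarrow> indep B \<and> (\<forall>X. indep X \<longrightarrow> B \<subseteq> X \<longrightarrow> X = B)"

definition circuit :: "'a set \<Rightarrow> bool" where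
  "circuit C \<longleftrightarrow> C \<subseteq> E \<and> \<not> indep C \<and> (\<forall>X. X \<subset> C \<longrightarrow> indep X)"

definition rank :: nat where
  "rank = Max (card ` {X. indep X})"

(* The infimum of the empty set in enat is \<infinity>, the value for a matroid without circuits. *)
definition girth :: enat where
  "girth = (INF C \<in> {C. circuit C}. enat (card C))"

(* Colours are 1, ..., rank; the values of B at other arguments are irrelevant. *)
definition base_sequence :: "(nat \<Rightarrow> 'a set) \<Rightarrow> bool" where
  "base_sequence B \<longleftrightarrow> (\<forall>c \<in> {1..rank}. base (B c))"

definition disjoint_base_sequence :: "(nat \<Rightarrow> 'a set) \<Rightarrow> bool" where
  "disjoint_base_sequence B \<longleftrightarrow> base_sequence B \<and> disjoint_family_on B {1..rank}"

(* A rainbow base is its choice of representatives b, made extensional by PiE so that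
   different functions are different choices and rainbow bases can be counted. *)
definition rainbow_base :: "(nat \<Rightarrow> 'a set) \<Rightarrow> (nat \<Rightarrow> 'a) \<Rightarrow> bool" where
  "rainbow_base B b \<longleftrightarrow>
     b \<in> (\<Pi>\<^sub>E c \<in> {1..rank}. B c) \<and> inj_on b {1..rank} \<and> base (b ` {1..rank})"

definition disjoint_rainbow_bases ::
  "(nat \<Rightarrow> 'a set) \<Rightarrow> (nat \<Rightarrow> 'a) set \<Rightarrow> bool" where
  "disjoint_rainbow_bases B R \<longleftrightarrow>
     (\<forall>b \<in> R. rainbow_base B b) \<and>
     (\<forall>b \<in> R. \<forall>b' \<in> R. b \<noteq> b' \<longrightarrow> (\<forall>c \<in> {1..rank}. b c \<noteq> b' c))"

(* For a base sequence B there are only finitely many rainbow bases, so this is a maximum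
   over a finite nonempty set. *)
definition max_disjoint_rainbow :: "(nat \<Rightarrow> 'a set) \<Rightarrow> nat" where
  "max_disjoint_rainbow B = Max (card ` {R. disjoint_rainbow_bases B R})"

end

end

theory Submission
  imports Defs
begin

text \<open>
  Write \<open>b\<close> for the defect \<open>\<beta> n\<close>; the girth condition says that all sets of size at most
  \<open>n - b\<close> are independent. Fix \<open>t\<close> and consider families of \<open>t\<close> pairwise disjoint rainbow
  independent sets \<open>T\<^sub>j\<close> of maximum total size. If all of them have size \<open>n\<close>, they are the required
  rainbow bases. Call an element free if no \<open>T\<^sub>j\<close> contains it; each colour has at least \<open>n - t\<close> free
  elements.

  Suppose that \<open>T\<^sub>i\<close> is deficient, that is, smaller than \<open>n\<close>. A free element \<open>x\<close> of a colour missing in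
  \<open>T\<^sub>i\<close> closes a circuit with \<open>T\<^sub>i\<close>, by maximality, and every other element of that circuit can be
  replaced by \<open>x\<close>. Circuits are large, so all but fewer than \<open>b\<close> colours can be vacated from \<open>T\<^sub>i\<close>
  by at most one replacement (few_unvacatable_colours). Maximality now gives two facts about a colour \<open>d\<close>
  that can be vacated: all free elements of colour \<open>d\<close> lie in the closure of \<open>T\<^sub>i\<close>, and an element
  \<open>e \<in> T\<^sub>j\<close> of colour \<open>d\<close> outside this closure can be moved to \<open>T\<^sub>i\<close> without changing the total size.
  The move produces another family of maximum total size, in which \<open>T\<^sub>j - {e}\<close> is deficient
  (transfer_optimal).

  Such moves are used to explore maximum families. Let \<open>L\<close> be the intersection of the
  closures of the deficient sets met so far. If \<open>k \<le> b\<close> families were met, some further move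
  lowers the rank of \<open>L\<close> (exploration_extends): each colour has at least \<open>m = n - r(L)\<close> elements outside
  \<open>L\<close>, and for almost all colours these are not free, so they are shared by the \<open>t\<close> sets \<open>T\<^sub>j\<close>; but if
  no move lowers the rank, then a set \<open>T\<^sub>j\<close> that took part in no move contains at most \<open>m\<close> of them,
  and the at most \<open>k\<close> other sets contain at most \<open>k * m\<close> each, up to a bounded error.
  This is too little as soon as \<open>n - t\<close> exceeds a quadratic function of \<open>b\<close>.
  After \<open>b\<close> moves the rank of \<open>L\<close> is below \<open>n - b\<close>, although \<open>L\<close> contains nearly all free elements
  of nearly all colours, and hence an independent set of size \<open>n - b\<close>. This is a contradiction
  (no_long_exploration). The argument works whenever \<open>t + 2 * b\<^sup>2 + 3 \<le> n\<close>, which covers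
  the bound in question.
\<close>

section \<open>Closures of independent sets\<close>

context matroid
begin

lemma finite_indep: "indep X \<Longrightarrow> finite X"
  using finite_ground indep_subset_ground finite_subset by blast

text \<open>The closure (span) of \<open>T\<close> if \<open>T\<close> is independent; for dependent \<open>T \<subseteq> E\<close> it is \<open>E\<close>.\<close>
definition cl :: "'a set \<Rightarrow> 'a set" where
  "cl T = {x \<in> E. x \<in> T \<or> \<not> indep (insert x T)}"

definition set_rank :: "'a set \<Rightarrow> nat" where
  "set_rank X = Max (card ` {I. indep I \<and> I \<subseteq> X})"

lemma finite_indep_sets: "finite {I. indep I}"
  by (rule finite_subset[of _ "Pow E"]) (use indep_subset_ground finite_ground in auto)

lemma card_le_set_rank: "indep I \<Longrightarrow> I \<subseteq> X \<Longrightarrow> card I \<le> set_rank X"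
  unfolding set_rank_def
  by (rule Max_ge) (auto intro: finite_subset[OF _ finite_indep_sets])

lemma set_rank_witness: obtains I where "indep I" "I \<subseteq> X" "card I = set_rank X"
proof -
  have "set_rank X \<in> card ` {I. indep I \<and> I \<subseteq> X}"
    unfolding set_rank_def
    by (rule Max_in) (use indep_empty in \<open>auto intro: finite_subset[OF _ finite_indep_sets]\<close>)
  then show thesis using that by auto
qed

lemma subset_cl: "indep T \<Longrightarrow> T \<subseteq> cl T"
  using indep_subset_ground by (auto simp: cl_def)

lemma card_indep_cl: "indep T \<Longrightarrow> indep I \<Longrightarrow> I \<subseteq> cl T \<Longrightarrow> card I \<le> card T"
  using augmentation[of T I] by (force simp: cl_def)

lemma extend_indep:
  assumes "indep I" "indep T" "card I \<le> card T"
  obtains J where "indep J" "I \<subseteq> J" "J \<subseteq> I \<union> T" "card J = card T"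
proof -
  have "\<exists>J. indep J \<and> I \<subseteq> J \<and> J \<subseteq> I \<union> T \<and> card J = card T"
    using assms
  proof (induction "card T - card I" arbitrary: I)
    case 0
    then show ?case by (intro exI[of _ I]) auto
  next
    case (Suc m)
    then have "card I < card T" by simp
    then obtain y where y: "y \<in> T - I" "indep (insert y I)"
      using augmentation Suc.prems by blast
    then have "card (insert y I) = Suc (card I)"
      using finite_indep Suc.prems by (simp add: card_insert_if)
    then have "m = card T - card (insert y I)" "card (insert y I) \<le> card T"
      using Suc.hyps(2) \<open>card I < card T\<close> by simp_all
    then obtain J where "indep J" "insert y I \<subseteq> J" "J \<subseteq> insert y I \<union> T" "card J = card T"
      using Suc.hyps(1)[OF _ y(2) Suc.prems(2)] by blast
    then show ?case using y by blast
  qed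
  then show thesis using that by blast
qed

text \<open>A point of \<open>cl I\<close> outside \<open>cl T\<close> would make \<open>T\<close> larger by one while staying independent;
  augmenting from there a set between \<open>I\<close> and \<open>I \<union> T\<close> of the size of \<open>T\<close> either exceeds the rank of
  \<open>cl T\<close> or shows that the point is not in \<open>cl I\<close>.\<close>
lemma cl_subset_cl:
  assumes T: "indep T" and I: "indep I" and "I \<subseteq> cl T"
  shows "cl I \<subseteq> cl T"
proof
  fix x assume x: "x \<in> cl I"
  show "x \<in> cl T"
  proof (rule ccontr)
    assume nx: "x \<notin> cl T"
    then have xT: "x \<notin> T" "indep (insert x T)" using x by (auto simp: cl_def)
    obtain J where J: "indep J" "I \<subseteq> J" "J \<subseteq> I \<union> T" "card J = card T"
      using extend_indep[OF I T] card_indep_cl[OF T I] assms(3) by blast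
    have JT: "J \<subseteq> cl T" using J subset_cl[OF T] assms(3) by auto
    have "card J < card (insert x T)" using J xT finite_indep[OF T] by simp
    then obtain y where y: "y \<in> insert x T - J" "indep (insert y J)"
      using augmentation[OF J(1) xT(2)] by blast
    show False
    proof (cases "y = x")
      case True
      then have "indep (insert x I)" using indep_mono[OF y(2), of "insert x I"] J by auto
      then show False using x nx assms(3) by (auto simp: cl_def)
    next
      case False
      then have "insert y J \<subseteq> cl T" using y JT subset_cl[OF T] by auto
      then have "card (insert y J) \<le> card T" using card_indep_cl[OF T] y by blast
      then show False using y J finite_indep[OF J(1)] by simp
    qed
  qed
qed

lemma set_rank_cl_le: "indep T \<Longrightarrow> L \<subseteq> cl T \<Longrightarrow> set_rank L \<le> card T"
  by (metis set_rank_witness[of L] card_indep_cl[of T] subset_trans)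

text \<open>The rank drops because a point of \<open>L\<close> outside \<open>cl T\<close> extends every independent subset of
  \<open>L \<inter> cl T\<close>.\<close>
lemma set_rank_Int_cl_less:
  assumes T: "indep T" and "L \<subseteq> E" "\<not> L \<subseteq> cl T"
  shows "set_rank (L \<inter> cl T) < set_rank L"
proof -
  obtain I where I: "indep I" "I \<subseteq> L \<inter> cl T" "card I = set_rank (L \<inter> cl T)"
    by (rule set_rank_witness)
  obtain x where x: "x \<in> L" "x \<notin> cl T" using assms by auto
  have "x \<notin> cl I" using cl_subset_cl[OF T I(1)] I x by auto
  then have "x \<notin> I" "indep (insert x I)" using x assms by (auto simp: cl_def)
  moreover have "insert x I \<subseteq> L" using I x by auto
  ultimately show ?thesis
    using card_le_set_rank[of "insert x I" L] I finite_indep[OF I(1)] by simp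
qed

text \<open>The closure of \<open>T - A\<close> is the intersection of the closures of the sets \<open>T - {e}\<close>: the
  fundamental circuit of \<open>f\<close> avoids every \<open>e \<in> A\<close>. The proof removes one element at a time by the
  exchange property.\<close>
lemma in_cl_Diff:
  assumes T: "indep T" and "finite A" "A \<subseteq> T" "f \<in> cl T" "\<And>e. e \<in> A \<Longrightarrow> f \<in> cl (T - {e})"
  shows "f \<in> cl (T - A)"
  using assms(2-)
proof (induction A)
  case empty
  then show ?case by simp
next
  case (insert e A)
  then have IH: "f \<in> cl (T - A)" and fe: "f \<in> cl (T - {e})" and e: "e \<in> T" "e \<notin> A" by auto
  have ind: "indep (T - A)" "indep (T - {e})" using indep_mono[OF T] by auto
  define W where "W = T - insert e A"
  have W: "T - A = insert e W" "e \<notin> W" "W \<subseteq> T - {e}" "finite W"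
    using e finite_indep[OF T] by (auto simp: W_def)
  have "f \<in> cl W"
  proof (rule ccontr)
    assume nf: "f \<notin> cl W"
    define I where "I = insert f W"
    have "f \<in> E" using IH by (simp add: cl_def)
    then have fW: "f \<notin> W" and I: "indep I"
      using nf by (auto simp: cl_def I_def)
    have card_I: "card I = card (T - A)" using W fW by (simp add: I_def)
    have IA: "I \<subseteq> cl (T - A)" using IH subset_cl[OF ind(1)] W(1) by (auto simp: I_def)
    have "e \<in> I \<or> \<not> indep (insert e I)"
    proof (rule ccontr)
      assume ne: "\<not> ?thesis"
      have "insert e I \<subseteq> cl (T - A)" using IA subset_cl[OF ind(1)] W(1) by blast
      then have "card (insert e I) \<le> card (T - A)" using card_indep_cl[OF ind(1)] ne by blast
      then show False using card_I ne finite_indep[OF I] by simp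
    qed
    then have "e \<in> cl I" using e indep_subset_ground[OF T] by (auto simp: cl_def)
    moreover have "I \<subseteq> cl (T - {e})" using fe subset_cl[OF ind(2)] W(3) by (auto simp: I_def)
    ultimately have "e \<in> cl (T - {e})" using cl_subset_cl[OF ind(2) I] by blast
    moreover have "insert e (T - {e}) = T" using e by blast
    ultimately show False using T by (simp add: cl_def)
  qed
  then show ?case by (simp only: W_def)
qed

text \<open>Consequently a set that stays spanned whichever element of \<open>A\<close> is removed is spanned by
  \<open>T - A\<close>.\<close>
lemma set_rank_plus_card_le:
  assumes T: "indep T" and A: "A \<subseteq> T" and "L \<subseteq> E" "L \<subseteq> cl T"
    and "\<And>e. e \<in> A \<Longrightarrow> L \<subseteq> cl (T - {e})"
  shows "set_rank L + card A \<le> card T"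
proof -
  have fin: "finite T" "finite A" using finite_indep[OF T] A finite_subset by auto
  have "L \<subseteq> cl (T - A)" using in_cl_Diff[OF T fin(2) A] assms by blast
  then have "set_rank L \<le> card (T - A)"
    using set_rank_cl_le[OF indep_mono[OF T Diff_subset]] by simp
  moreover have "card (T - A) + card A = card T"
    using card_Diff_subset[OF fin(2) A] card_mono[OF fin(1) A] by simp
  ultimately show ?thesis by simp
qed

text \<open>The fundamental circuit of \<open>x\<close>, described by the exchanges it permits. If it were
  independent, it could be completed from \<open>T\<close> to an independent set of the size of \<open>T\<close> that leaves
  out exactly one \<open>y \<in> T\<close>, and such a \<open>y\<close> is swappable itself.\<close>
lemma dependent_swappable:
  assumes T: "indep T" and x: "x \<in> cl T" "x \<notin> T"
  shows "\<not> indep (insert x {y \<in> T. indep (insert x (T - {y}))})"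
    (is "\<not> indep (insert x ?D)")
proof
  assume D: "indep (insert x ?D)"
  have sub: "insert x ?D \<subseteq> cl T" using x subset_cl[OF T] by auto
  obtain J where J: "indep J" "insert x ?D \<subseteq> J" "J \<subseteq> insert x ?D \<union> T" "card J = card T"
    using extend_indep[OF D T card_indep_cl[OF T D sub]] by blast
  have fin: "finite J" "finite T" using J(1) T finite_indep by auto
  have "\<not> T \<subseteq> J"
  proof
    assume "T \<subseteq> J"
    then have "insert x T \<subseteq> J" using J by auto
    then have "card (insert x T) \<le> card J" using fin card_mono by blast
    then show False using J x fin by simp
  qed
  then obtain y where y: "y \<in> T" "y \<notin> J" by auto
  have "J \<subseteq> insert x (T - {y})" using J y by auto
  moreover have "card (insert x (T - {y})) = card T"
    using x y fin card_Suc_Diff1[of T y] by simp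
  ultimately have "J = insert x (T - {y})"
    using J fin card_subset_eq[of "insert x (T - {y})" J] by simp
  then have "y \<in> ?D" using J y by auto
  then show False using J y by auto
qed

lemma card_le_rank: "indep I \<Longrightarrow> card I \<le> rank"
  unfolding rank_def by (rule Max_ge) (use finite_indep_sets in auto)

lemma base_iff_card_rank: "base B \<longleftrightarrow> indep B \<and> card B = rank"
proof
  assume B: "base B"
  then have iB: "indep B" by (simp add: base_def)
  have "rank \<in> card ` {X. indep X}"
    unfolding rank_def by (rule Max_in) (use finite_indep_sets indep_empty in auto)
  then obtain I where I: "indep I" "card I = rank" by auto
  have "\<not> card B < card I"
    using augmentation[OF iB I(1)] B by (auto simp: base_def)
  then show "indep B \<and> card B = rank" using I card_le_rank[OF iB] iB by auto
next
  assume B: "indep B \<and> card B = rank"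
  have "X = B" if X: "indep X" "B \<subseteq> X" for X
  proof -
    have "card X \<le> card B" using B card_le_rank[OF X(1)] by simp
    then show ?thesis using card_seteq[OF finite_indep[OF X(1)] X(2)] by simp
  qed
  then show "base B" using B by (simp add: base_def)
qed

lemma dependent_contains_circuit:
  assumes "X \<subseteq> E" "\<not> indep X"
  obtains C where "circuit C" "C \<subseteq> X"
proof -
  have "finite X" using assms finite_ground finite_subset by blast
  then have "\<exists>C\<subseteq>X. circuit C" using assms
  proof (induction X rule: finite_psubset_induct)
    case (psubset X)
    show ?case
    proof (cases "circuit X")
      case False
      then obtain Z where Z: "Z \<subset> X" "\<not> indep Z" using psubset.prems by (auto simp: circuit_def)
      then have "Z \<subseteq> E" using psubset.prems by blast
      then obtain C where "C \<subseteq> Z" "circuit C" using psubset.IH[OF Z(1)] Z(2) by auto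
      then show ?thesis using Z by blast
    qed auto
  qed
  then show thesis using that by blast
qed

lemma indep_if_card_less_girth:
  assumes "X \<subseteq> E" "enat (card X) < girth"
  shows "indep X"
proof (rule ccontr)
  assume "\<not> indep X"
  then obtain C where C: "circuit C" "C \<subseteq> X" using dependent_contains_circuit assms by blast
  have "girth \<le> enat (card C)" unfolding girth_def by (rule INF_lower) (use C in simp)
  also have "\<dots> \<le> enat (card X)"
    using C assms finite_ground by (auto intro: card_mono finite_subset)
  finally show False using assms by simp
qed

end

section \<open>Families of disjoint rainbow independent sets\<close>

locale coloured_matroid = matroid E indep for E :: "'a set" and indep +
  fixes n b t :: nat and U :: "'a set" and col :: "'a \<Rightarrow> nat"
  assumes U_subset: "U \<subseteq> E"
    and col_range: "e \<in> U \<Longrightarrow> col e \<in> {1..n}"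
    and colour_indep: "c \<in> {1..n} \<Longrightarrow> indep {e \<in> U. col e = c}"
    and colour_card: "c \<in> {1..n} \<Longrightarrow> card {e \<in> U. col e = c} = n"
    and card_indep_le: "indep I \<Longrightarrow> card I \<le> n"
    and small_indep: "X \<subseteq> E \<Longrightarrow> card X + b \<le> n \<Longrightarrow> indep X"
    and b_pos: "b \<ge> 1"
    and t_bound: "t + 2 * b\<^sup>2 + 3 \<le> n"
begin

definition valid :: "(nat \<Rightarrow> 'a set) \<Rightarrow> bool" where
  "valid T \<longleftrightarrow> (\<forall>j<t. T j \<subseteq> U \<and> indep (T j) \<and> inj_on col (T j)) \<and> disjoint_family_on T {..<t}"

definition total :: "(nat \<Rightarrow> 'a set) \<Rightarrow> nat" where
  "total T = (\<Sum>j<t. card (T j))"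

definition optimal :: "(nat \<Rightarrow> 'a set) \<Rightarrow> bool" where
  "optimal T \<longleftrightarrow> valid T \<and> (\<forall>T'. valid T' \<longrightarrow> total T' \<le> total T)"

definition free :: "(nat \<Rightarrow> 'a set) \<Rightarrow> 'a set" where
  "free T = U - (\<Union>j<t. T j)"

text \<open>\<open>S\<close> arises from \<open>T i\<close> by at most one exchange with a free element, and misses colour \<open>d\<close>.
  It is spanned by \<open>T i\<close>, so what lies outside the closure of \<open>T i\<close> is independent of \<open>S\<close> too.
  If \<open>T i\<close> misses \<open>d\<close> already, then \<open>S = T i\<close> qualifies.\<close>
definition vacates :: "'a set \<Rightarrow> (nat \<Rightarrow> 'a set) \<Rightarrow> nat \<Rightarrow> nat \<Rightarrow> bool" where
  "vacates S T i d \<longleftrightarrow> S \<subseteq> U \<and> indep S \<and> inj_on col S \<and> card S = card (T i) \<and> S \<subseteq> cl (T i) \<and>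
     d \<notin> col ` S \<and> S - T i \<subseteq> free T \<and> card (S - T i) \<le> 1 \<and> card (T i - S) \<le> 1"

lemma finite_U: "finite U"
  using U_subset finite_ground finite_subset by blast

lemma exists_optimal: "\<exists>T. optimal T"
proof -
  have "\<exists>T. valid T \<and> (\<forall>T'. valid T' \<longrightarrow> total T' \<le> total T)"
  proof (rule ex_has_greatest_nat[of valid "\<lambda>_. {}" total "Suc (t * n)"])
    show "valid (\<lambda>_. {})" by (simp add: valid_def indep_empty disjoint_family_on_def)
    show "\<forall>T. valid T \<longrightarrow> total T < Suc (t * n)"
    proof (intro allI impI)
      fix T assume "valid T"
      then have "total T \<le> (\<Sum>j<t. n)"
        unfolding total_def by (intro sum_mono) (auto simp: valid_def intro: card_indep_le)
      then show "total T < Suc (t * n)" by simp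
    qed
  qed
  then show ?thesis by (simp add: optimal_def)
qed

lemma total_update:
  assumes "i < t"
  shows "total (T(i := S)) + card (T i) = total T + card S"
proof -
  have "total (T(i := S)) = card S + (\<Sum>j\<in>{..<t}-{i}. card (T j))"
    unfolding total_def using assms by (subst sum.remove[of _ i]) (auto intro: sum.cong)
  moreover have "total T = card (T i) + (\<Sum>j\<in>{..<t}-{i}. card (T j))"
    unfolding total_def using assms by (subst sum.remove[of _ i]) auto
  ultimately show ?thesis by simp
qed

lemma valid_update:
  assumes "valid T" "S \<subseteq> U" "indep S" "inj_on col S" "S - T i \<subseteq> free T"
  shows "valid (T(i := S))"
proof -
  have "disjoint_family_on (T(i := S)) {..<t}"
    using assms unfolding valid_def disjoint_family_on_def free_def by auto blast+
  then show ?thesis using assms by (auto simp: valid_def)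
qed

lemma indep_insert_if_not_in_cl: "e \<in> U \<Longrightarrow> e \<notin> cl T \<Longrightarrow> indep (insert e T)"
  using U_subset by (auto simp: cl_def)

text \<open>Otherwise \<open>insert f S\<close> in place of \<open>T i\<close> would give a larger family.\<close>
lemma free_in_cl_of_replacement:
  assumes "optimal T" "i < t" "S \<subseteq> U" "indep S" "inj_on col S" "card S = card (T i)"
    and "S - T i \<subseteq> free T" "f \<in> free T" "col f \<notin> col ` S"
  shows "f \<in> cl S"
proof (rule ccontr)
  assume nf: "f \<notin> cl S"
  have fU: "f \<in> U" and fS: "f \<notin> S" using assms by (auto simp: free_def)
  have "valid (T(i := insert f S))"
    using assms fU nf by (intro valid_update) (auto simp: optimal_def indep_insert_if_not_in_cl)
  then have "total (T(i := insert f S)) \<le> total T" using assms by (simp add: optimal_def)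
  then show False
    using total_update[OF \<open>i < t\<close>, of T "insert f S"] fS assms(6) finite_indep[OF \<open>indep S\<close>] by simp
qed

lemma free_in_cl_if_vacates:
  assumes "optimal T" "i < t" "vacates S T i (col f)" "f \<in> free T"
  shows "f \<in> cl (T i)"
proof -
  have "indep (T i)" using assms by (auto simp: optimal_def valid_def)
  then have "cl S \<subseteq> cl (T i)" using assms(3) cl_subset_cl[of "T i" S] by (simp add: vacates_def)
  moreover have "f \<in> cl S"
    using assms by (intro free_in_cl_of_replacement[of T i]) (auto simp: vacates_def)
  ultimately show ?thesis by auto
qed

lemma card_colour_rainbow_le:
  assumes "inj_on col T" shows "card {e \<in> T. col e = d} \<le> 1"
proof (cases "{e \<in> T. col e = d} = {}")
  case False
  then obtain a where "a \<in> T" "col a = d" by blast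
  then have "{e \<in> T. col e = d} \<subseteq> {a}" using assms by (auto dest: inj_onD)
  then show ?thesis using card_mono[of "{a}"] by simp
next
  case True
  then show ?thesis by (simp only: card.empty zero_le)
qed

text \<open>Each of the \<open>t\<close> rainbow sets uses at most one element of a colour.\<close>
lemma card_free_colour:
  assumes "valid T" "d \<in> {1..n}"
  shows "card {e \<in> free T. col e = d} + t \<ge> n"
proof -
  have "{e \<in> U. col e = d} \<subseteq> {e \<in> free T. col e = d} \<union> (\<Union>j<t. {e \<in> T j. col e = d})"
    by (auto simp: free_def)
  moreover have "finite ({e \<in> free T. col e = d} \<union> (\<Union>j<t. {e \<in> T j. col e = d}))"
    by (rule finite_subset[OF _ finite_U]) (use assms in \<open>auto simp: free_def valid_def\<close>)
  ultimately have "card {e \<in> U. col e = d} \<le> card ({e \<in> free T. col e = d} \<union> (\<Union>j<t. {e \<in> T j. col e = d}))"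
    by (intro card_mono)
  also have "\<dots> \<le> card {e \<in> free T. col e = d} + card (\<Union>j<t. {e \<in> T j. col e = d})"
    by (rule card_Un_le)
  also have "card (\<Union>j<t. {e \<in> T j. col e = d}) \<le> (\<Sum>j<t. card {e \<in> T j. col e = d})"
    by (rule card_UN_le) simp
  also have "\<dots> \<le> (\<Sum>j<t. 1)"
    using assms by (intro sum_mono card_colour_rainbow_le) (auto simp: valid_def)
  finally show ?thesis using colour_card[OF assms(2)] by simp
qed

text \<open>The elements of \<open>T i\<close> in the fundamental circuit of a free element \<open>x\<close> of a missing colour can
  be exchanged for \<open>x\<close>. The circuit has more than \<open>n - b\<close> elements and \<open>T i\<close> has fewer than \<open>n\<close>, so fewer
  than \<open>b\<close> elements of \<open>T i\<close> lie off the circuit.\<close>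
lemma few_unvacatable_colours:
  assumes opt: "optimal T" and i: "i < t" and def: "card (T i) < n"
  shows "card {d \<in> {1..n}. \<not> (\<exists>S. vacates S T i d)} < b"
proof -
  have val: "valid T" and TU: "T i \<subseteq> U" and Ti: "indep (T i)" and inj: "inj_on col (T i)"
    using opt i by (auto simp: optimal_def valid_def)
  have fin: "finite (T i)" using finite_indep[OF Ti] .
  have missing: "\<exists>S. vacates S T i d" if "d \<notin> col ` T i" for d
    using that TU Ti inj subset_cl[OF Ti] by (intro exI[of _ "T i"]) (auto simp: vacates_def)
  have "card (col ` T i) < card {1..n}"
    using card_image[OF inj] def by simp
  then have "\<not> {1..n} \<subseteq> col ` T i"
    using card_mono[OF finite_imageI[OF fin], of "{1..n}" col] leD by blast
  then obtain c where c: "c \<in> {1..n}" "c \<notin> col ` T i" by blast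
  have "card {e \<in> free T. col e = c} > 0"
    using card_free_colour[OF val c(1)] t_bound by simp
  then obtain x where x: "x \<in> free T" "col x = c"
    by (auto simp: card_gt_0_iff)
  have xU: "x \<in> U" and xT: "x \<notin> T i" using x i by (auto simp: free_def)
  have xcl: "x \<in> cl (T i)"
    using free_in_cl_if_vacates[OF opt i _ x(1)] missing[OF c(2)] x(2) by auto
  define D where "D = {y \<in> T i. indep (insert x (T i - {y}))}"
  have DT: "D \<subseteq> T i" by (auto simp: D_def)
  have finD: "finite D" using DT fin finite_subset by blast
  have "\<not> indep (insert x D)"
    unfolding D_def by (rule dependent_swappable[OF Ti xcl xT])
  moreover have "insert x D \<subseteq> E" using DT TU xU U_subset by blast
  ultimately have "n < card (insert x D) + b"
    using small_indep[of "insert x D"] by linarith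
  then have cD: "n \<le> card D + b"
    using finD by (simp add: card_insert_if split: if_splits)
  have swap: "\<exists>S. vacates S T i (col y)" if y: "y \<in> D" for y
  proof -
    define S where "S = insert x (T i - {y})"
    have yT: "y \<in> T i" and S: "indep S" using y by (auto simp: D_def S_def)
    have "vacates S T i (col y)"
      unfolding vacates_def
    proof (intro conjI)
      show "S \<subseteq> U" using TU xU by (auto simp: S_def)
      show "indep S" by fact
      show "inj_on col S"
        using inj_on_diff[OF inj] c x by (auto simp: S_def)
      show "card S = card (T i)" using xT yT fin card_Suc_Diff1[of "T i" y] by (simp add: S_def)
      show "S \<subseteq> cl (T i)" using xcl subset_cl[OF Ti] by (auto simp: S_def)
      show "col y \<notin> col ` S"
      proof
        assume "col y \<in> col ` S"
        then obtain z where z: "z \<in> S" "col y = col z" by blast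
        have "z \<noteq> x" using z(2) c(2) x(2) imageI[OF yT, of col] by auto
        then have "z \<in> T i - {y}" using z(1) by (simp add: S_def)
        then show False using inj_onD[OF inj z(2) yT] by simp
      qed
      have "S - T i \<subseteq> {x}" by (auto simp: S_def)
      then show "S - T i \<subseteq> free T" "card (S - T i) \<le> 1"
        using x card_mono[of "{x}" "S - T i"] by auto
      have "T i - S \<subseteq> {y}" by (auto simp: S_def)
      then show "card (T i - S) \<le> 1" using card_mono[of "{y}" "T i - S"] by auto
    qed
    then show ?thesis ..
  qed
  have "{d \<in> {1..n}. \<not> (\<exists>S. vacates S T i d)} \<subseteq> col ` (T i - D)"
  proof
    fix d assume d: "d \<in> {d \<in> {1..n}. \<not> (\<exists>S. vacates S T i d)}"
    then have "d \<in> col ` T i" using missing by auto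
    then obtain y where y: "y \<in> T i" "d = col y" by blast
    then have "y \<notin> D" using swap d by auto
    then show "d \<in> col ` (T i - D)" using y by simp
  qed
  then have "card {d \<in> {1..n}. \<not> (\<exists>S. vacates S T i d)} \<le> card (col ` (T i - D))"
    by (rule card_mono[rotated]) (simp add: fin)
  also have "\<dots> \<le> card (T i - D)" using fin by (simp add: card_image_le)
  also have "\<dots> = card (T i) - card D" using card_Diff_subset[OF finD DT] .
  also have "\<dots> < b" using cD def b_pos by linarith
  finally show ?thesis .
qed

text \<open>Vacating the colour of \<open>e\<close> in \<open>T i\<close> and moving \<open>e\<close> there keeps the total size. The last two
  claims record how little changes: at most two elements leave the set that contained them, and at
  most one free element is lost.\<close>
lemma transfer_optimal:
  assumes opt: "optimal T" and i: "i < t" and j: "j < t" and S: "vacates S T i (col e)"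
    and e: "e \<in> T j" "e \<notin> cl (T i)"
  defines "T' \<equiv> T(j := T j - {e}, i := insert e S)"
  shows "j \<noteq> i" "optimal T'" "card (T' j) < n" "T k - T' k \<subseteq> insert e (T i - S)"
    "free T - free T' \<subseteq> S - T i"
proof -
  have val: "valid T" and Ti: "indep (T i)" and Tj: "indep (T j)" "inj_on col (T j)" "T j \<subseteq> U"
    using opt i j by (auto simp: optimal_def valid_def)
  show ji: "j \<noteq> i" using e subset_cl[OF Ti] by auto
  have S': "S \<subseteq> U" "indep S" "inj_on col S" "card S = card (T i)" "S \<subseteq> cl (T i)"
    "col e \<notin> col ` S" "S - T i \<subseteq> free T"
    using S by (auto simp: vacates_def)
  have eS: "e \<notin> S" using S' by auto
  have ncl: "e \<notin> cl S" using cl_subset_cl[OF Ti S'(2,5)] e by auto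
  have val1: "valid (T(j := T j - {e}))"
    using Tj val by (intro valid_update) (auto intro: indep_mono inj_on_diff)
  have "e \<notin> T l" if "l < t" "l \<noteq> j" for l
    using val disjoint_family_onD[of T "{..<t}" l j] that j e by (auto simp: valid_def)
  then have e_free: "e \<in> free (T(j := T j - {e}))"
    using e Tj by (auto simp: free_def split: if_splits)
  have free1: "free T \<subseteq> free (T(j := T j - {e}))" by (auto simp: free_def split: if_splits)
  have val': "valid T'"
    unfolding T'_def
  proof (rule valid_update[OF val1])
    show "insert e S \<subseteq> U" using S' Tj e by auto
    show "indep (insert e S)" using ncl e Tj by (intro indep_insert_if_not_in_cl) auto
    show "inj_on col (insert e S)" using S' by auto
    show "insert e S - (T(j := T j - {e})) i \<subseteq> free (T(j := T j - {e}))"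
      using S' e_free free1 ji by auto
  qed
  have "total T' = total T"
  proof -
    have "total T' + card (T i) = total (T(j := T j - {e})) + card (insert e S)"
      using total_update[OF i, of "T(j := T j - {e})" "insert e S"] ji by (simp add: T'_def)
    moreover have "total (T(j := T j - {e})) + card (T j) = total T + card (T j - {e})"
      by (rule total_update[OF j])
    moreover have "card (T j) = Suc (card (T j - {e}))"
      using e finite_indep[OF Tj(1)] card_Suc_Diff1[of "T j" e] by simp
    ultimately show ?thesis using S' eS finite_indep[OF S'(2)] by simp
  qed
  then show "optimal T'" using opt val' by (simp add: optimal_def)
  have "card (T j - {e}) < card (T j)"
    using e finite_indep[OF Tj(1)] by (meson card_Diff1_less)
  then show "card (T' j) < n" using card_indep_le[OF Tj(1)] ji by (simp add: T'_def)
  show "T k - T' k \<subseteq> insert e (T i - S)" by (auto simp: T'_def)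
  show "free T - free T' \<subseteq> S - T i"
  proof
    fix f assume f: "f \<in> free T - free T'"
    then obtain l where l: "l < t" "f \<in> T' l" by (auto simp: free_def)
    have "f \<notin> T l" "f \<noteq> e" "f \<notin> T i" using f l e j i by (auto simp: free_def)
    then show "f \<in> S - T i" using l by (auto simp: T'_def split: if_splits)
  qed
qed

section \<open>Exploring optimal families\<close>

definition common_flat :: "((nat \<Rightarrow> 'a set) \<times> nat) set \<Rightarrow> 'a set" where
  "common_flat \<C> = (\<Inter>(T, i)\<in>\<C>. cl (T i))"

text \<open>What remains under control in a family \<open>T'\<close> obtained from \<open>T\<close> by transfers, with deficient
  member \<open>i\<close>: \<open>X\<close> collects the elements that left their sets, \<open>Y\<close> the free elements that were used, and
  \<open>J\<close> the indices of the sets that took part in a transfer.\<close>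
definition reached ::
  "(nat \<Rightarrow> 'a set) \<Rightarrow> 'a set \<Rightarrow> 'a set \<Rightarrow> nat set \<Rightarrow> (nat \<Rightarrow> 'a set) \<Rightarrow> nat \<Rightarrow> bool"
where
  "reached T X Y J T' i \<longleftrightarrow>
     optimal T' \<and> i < t \<and> i \<in> J \<and> card (T' i) < n \<and>
     (\<forall>j<t. T j - T' j \<subseteq> X) \<and> (\<forall>j. j \<notin> J \<longrightarrow> T' j = T j) \<and> free T - free T' \<subseteq> Y"

text \<open>The sets \<open>X\<close>, \<open>Y\<close> and \<open>J\<close> serve all families of \<open>\<C>\<close> together. This is possible because every new
  family differs by a single transfer from an earlier one; it also makes their sizes linear in
  the number \<open>k\<close> of families.\<close>
definition exploration ::
  "(nat \<Rightarrow> 'a set) \<Rightarrow> nat \<Rightarrow> ((nat \<Rightarrow> 'a set) \<times> nat) set \<Rightarrow> 'a set \<Rightarrow> 'a set \<Rightarrow> nat set \<Rightarrow> bool"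
where
  "exploration T k \<C> X Y J \<longleftrightarrow>
     finite \<C> \<and> \<C> \<noteq> {} \<and> card \<C> \<le> k \<and> finite X \<and> card X \<le> 2 * k \<and> finite Y \<and> card Y \<le> k \<and>
     finite J \<and> card J \<le> k \<and> set_rank (common_flat \<C>) + k \<le> n \<and>
     (\<forall>(T', i)\<in>\<C>. reached T X Y J T' i)"

definition vacatable :: "((nat \<Rightarrow> 'a set) \<times> nat) set \<Rightarrow> nat set" where
  "vacatable \<C> = {d \<in> {1..n}. \<forall>(T, i)\<in>\<C>. \<exists>S. vacates S T i d}"

lemma explorationD:
  assumes "exploration T k \<C> X Y J" "(T', i) \<in> \<C>"
  shows "optimal T'" "i < t" "i \<in> J" "card (T' i) < n" "\<And>j. j < t \<Longrightarrow> T j - T' j \<subseteq> X"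
    "\<And>j. j \<notin> J \<Longrightarrow> T' j = T j" "free T - free T' \<subseteq> Y"
proof -
  have "reached T X Y J T' i" using assms by (auto simp: exploration_def)
  then show "optimal T'" "i < t" "i \<in> J" "card (T' i) < n" "\<And>j. j < t \<Longrightarrow> T j - T' j \<subseteq> X"
    "\<And>j. j \<notin> J \<Longrightarrow> T' j = T j" "free T - free T' \<subseteq> Y" by (auto simp: reached_def)
qed

lemma common_flat_subset: "\<C> \<noteq> {} \<Longrightarrow> common_flat \<C> \<subseteq> E"
  by (auto simp: common_flat_def cl_def)

lemma card_vacatable:
  assumes ex: "exploration T k \<C> X Y J"
  shows "n \<le> card (vacatable \<C>) + k * (b - 1)"
proof -
  define R where "R = (\<lambda>(T, i). {d \<in> {1..n}. \<not> (\<exists>S. vacates S T i d)})"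
  have fin: "finite \<C>" "card \<C> \<le> k" using ex by (auto simp: exploration_def)
  have le: "card (R p) \<le> b - 1" if "p \<in> \<C>" for p
  proof -
    obtain T' i where p: "p = (T', i)" by fastforce
    then have "optimal T'" "i < t" "card (T' i) < n"
      using explorationD[OF ex] that by auto
    then show ?thesis using few_unvacatable_colours p by (fastforce simp: R_def)
  qed
  have "{1..n} \<subseteq> vacatable \<C> \<union> (\<Union>p\<in>\<C>. R p)"
    by (auto simp: vacatable_def R_def)
  then have "card {1..n} \<le> card (vacatable \<C> \<union> (\<Union>p\<in>\<C>. R p))"
    by (rule card_mono[rotated]) (use fin in \<open>auto simp: vacatable_def R_def\<close>)
  also have "\<dots> \<le> card (vacatable \<C>) + card (\<Union>p\<in>\<C>. R p)" by (rule card_Un_le)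
  also have "card (\<Union>p\<in>\<C>. R p) \<le> (\<Sum>p\<in>\<C>. card (R p))" by (rule card_UN_le[OF fin(1)])
  also have "\<dots> \<le> (\<Sum>p\<in>\<C>. b - 1)" by (intro sum_mono le)
  also have "\<dots> \<le> k * (b - 1)" using fin by simp
  finally show ?thesis by simp
qed

lemma free_in_common_flat:
  assumes ex: "exploration T k \<C> X Y J" and f: "f \<in> free T" "col f \<in> vacatable \<C>" "f \<notin> Y"
  shows "f \<in> common_flat \<C>"
  unfolding common_flat_def
proof (clarify)
  fix T' i assume p: "(T', i) \<in> \<C>"
  then have T': "optimal T'" "i < t" "free T - free T' \<subseteq> Y"
    using explorationD[OF ex p] by auto
  obtain S where "vacates S T' i (col f)" using f p by (auto simp: vacatable_def)
  then show "f \<in> cl (T' i)" using free_in_cl_if_vacates T' f by blast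
qed

lemma card_colours_ge:
  assumes "G \<subseteq> {1..n}" "V \<subseteq> U" "\<And>d. d \<in> G \<Longrightarrow> m \<le> card {e \<in> V. col e = d}"
  shows "card G * m \<le> card {e \<in> V. col e \<in> G}"
proof -
  have finG: "finite G" using assms finite_subset by blast
  have finV: "finite V" using assms finite_U finite_subset by blast
  have "card G * m \<le> (\<Sum>d\<in>G. card {e \<in> V. col e = d})"
    using sum_mono[of G "\<lambda>_. m" "\<lambda>d. card {e \<in> V. col e = d}"] assms(3) by simp
  also have "\<dots> = card (\<Union>d\<in>G. {e \<in> V. col e = d})"
    by (rule card_UN_disjoint[symmetric]) (use finG finV in auto)
  also have "(\<Union>d\<in>G. {e \<in> V. col e = d}) = {e \<in> V. col e \<in> G}" by auto
  finally show ?thesis .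
qed

text \<open>A single transfer extends the exploration if it makes a set deficient whose closure does not
  contain the common flat.\<close>
lemma exploration_step:
  assumes ex: "exploration T k \<C> X Y J" and p: "(T', i) \<in> \<C>" and j: "j < t"
    and e: "e \<in> T' j" "e \<notin> cl (T' i)" "col e \<in> vacatable \<C>"
    and drop: "\<not> common_flat \<C> \<subseteq> cl (T' j - {e})"
  shows "\<exists>\<C>' X' Y' J'. exploration T (Suc k) \<C>' X' Y' J'"
proof -
  have T': "optimal T'" "i < t" "i \<in> J" "\<And>j. j < t \<Longrightarrow> T j - T' j \<subseteq> X"
    "\<And>j. j \<notin> J \<Longrightarrow> T' j = T j" "free T - free T' \<subseteq> Y"
    using explorationD[OF ex p] by auto
  obtain S where S: "vacates S T' i (col e)" using e p by (auto simp: vacatable_def)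
  define T'' where "T'' = T'(j := T' j - {e}, i := insert e S)"
  note tr = transfer_optimal[OF T'(1,2) j S e(1,2), folded T''_def]
  have cS: "card (S - T' i) \<le> 1" "card (T' i - S) \<le> 1" "finite S" "finite (T' i)"
    using S T' by (auto simp: vacates_def optimal_def valid_def intro: finite_indep)
  have T''j: "T'' j = T' j - {e}" using tr(1) by (simp add: T''_def)
  define X' where "X' = X \<union> insert e (T' i - S)"
  define Y' where "Y' = Y \<union> (S - T' i)"
  have fins: "finite \<C>" "\<C> \<noteq> {}" "card \<C> \<le> k" "finite X" "card X \<le> 2 * k" "finite Y" "card Y \<le> k"
     "finite J" "card J \<le> k" "set_rank (common_flat \<C>) + k \<le> n"
    using ex by (auto simp: exploration_def)
  have X': "card X' \<le> 2 * Suc k"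
  proof -
    have "card X' \<le> card X + card (insert e (T' i - S))" unfolding X'_def by (rule card_Un_le)
    also have "card (insert e (T' i - S)) \<le> 2" using cS by (simp add: card_insert_if)
    finally show ?thesis using fins by simp
  qed
  have Y': "card Y' \<le> Suc k"
    using card_Un_le[of Y "S - T' i"] cS fins by (simp add: Y'_def)
  have "indep (T' j)" using T' j by (auto simp: optimal_def valid_def)
  then have "indep (T'' j)" using T''j indep_mono by auto
  then have "set_rank (common_flat \<C> \<inter> cl (T'' j)) < set_rank (common_flat \<C>)"
    using set_rank_Int_cl_less common_flat_subset fins drop T''j by simp
  moreover have "common_flat (insert (T'', j) \<C>) = common_flat \<C> \<inter> cl (T'' j)"
    by (auto simp: common_flat_def)
  ultimately have rk: "set_rank (common_flat (insert (T'', j) \<C>)) + Suc k \<le> n"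
    using fins by simp
  have "reached T X' Y' (insert j J) T'' j"
    unfolding reached_def
  proof (intro conjI allI impI)
    show "T l - T'' l \<subseteq> X'" if "l < t" for l
      using tr(4)[of l] T'(4)[OF that] by (auto simp: X'_def)
    show "T'' l = T l" if "l \<notin> insert j J" for l
      using that T'(3) T'(5)[of l] by (auto simp: T''_def)
    show "free T - free T'' \<subseteq> Y'" using tr(5) T'(6) by (auto simp: Y'_def)
  qed (use tr j in auto)
  moreover have "reached T X' Y' (insert j J) T1 l" if "(T1, l) \<in> \<C>" for T1 l
    using explorationD[OF ex that] unfolding reached_def X'_def Y'_def by blast
  ultimately have "\<forall>(T1, l)\<in>insert (T'', j) \<C>. reached T X' Y' (insert j J) T1 l" by auto
  moreover have "card (insert (T'', j) \<C>) \<le> Suc k" "card (insert j J) \<le> Suc k"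
    using fins by (simp_all add: card_insert_if)
  moreover have "finite X'" "finite Y'" using fins cS by (simp_all add: X'_def Y'_def)
  ultimately have "exploration T (Suc k) (insert (T'', j) \<C>) X' Y' (insert j J)"
    unfolding exploration_def using fins X' Y' rk by simp
  then show ?thesis by blast
qed

text \<open>If no transfer lowers the rank of the common flat \<open>L\<close>, then \<open>L \<subseteq> cl (T' j - {e})\<close> for every \<open>e\<close>
  that could be transferred in a reached family \<open>T'\<close>, so by set_rank_plus_card_le the set \<open>T' j\<close> has
  at most \<open>m = n - r(L)\<close> such elements. Every element outside \<open>L\<close> misses the closure of the deficient
  set of some reached family, so it can be transferred there, provided that it still belongs to
  \<open>T' j\<close> (hence the removal of \<open>X\<close>) and has a colour in \<open>vacatable \<C>\<close>. For \<open>j \<notin> J\<close> the set \<open>T j\<close> is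
  the same in all families and the bound \<open>m\<close> applies once; for \<open>j \<in> J\<close> it applies once for each of the at
  most \<open>k\<close> families.\<close>
lemma exploration_extends:
  assumes ex: "exploration T k \<C> X Y J" and T: "valid T" and k: "1 \<le> k" "k \<le> b"
  shows "\<exists>\<C>' X' Y' J'. exploration T (Suc k) \<C>' X' Y' J'"
proof (rule ccontr)
  assume stuck: "\<not> ?thesis"
  define L where "L = common_flat \<C>"
  define m where "m = n - set_rank L"
  define G where "G = vacatable \<C>"
  define A where "A j = {e \<in> T j. col e \<in> G \<and> e \<notin> L}" for j
  have fins: "finite \<C>" "\<C> \<noteq> {}" "card \<C> \<le> k" "finite X" "card X \<le> 2 * k" "finite Y" "card Y \<le> k"
     "finite J" "card J \<le> k" "set_rank L + k \<le> n"
    using ex by (auto simp: exploration_def L_def)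
  have LE: "L \<subseteq> E" using common_flat_subset fins L_def by simp
  have T': "optimal T'" "i < t" "i \<in> J" "\<And>j. j < t \<Longrightarrow> T j - T' j \<subseteq> X"
     "\<And>j. j \<notin> J \<Longrightarrow> T' j = T j" if "(T', i) \<in> \<C>" for T' i
    using explorationD[OF ex that] by auto
  have finT: "finite (T j)" if "j < t" for j using T that by (auto simp: valid_def intro: finite_indep)
  \<comment> \<open>Here \<open>T'\<close> is any valid family, so that the bound applies to \<open>T\<close> and to the reached families.\<close>
  have bound: "card D \<le> m"
    if D: "D \<subseteq> T' j" and j: "j < t" and "valid T'" and cov: "\<And>e. e \<in> D \<Longrightarrow> L \<subseteq> cl (T' j - {e})" for D T' j
  proof (cases "D = {}")
    case False
    have ind: "indep (T' j)" using that by (auto simp: valid_def)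
    obtain e where e: "e \<in> D" using False by auto
    have "cl (T' j - {e}) \<subseteq> cl (T' j)"
      using indep_mono[OF ind] subset_cl[OF ind] by (intro cl_subset_cl[OF ind]) auto
    then have "set_rank L + card D \<le> card (T' j)"
      using set_rank_plus_card_le[OF ind D LE] cov e by blast
    then show ?thesis using card_indep_le[OF ind] by (simp add: m_def)
  qed simp
  have cover: "L \<subseteq> cl (T' j - {e})"
    if "(T', i) \<in> \<C>" "j < t" "e \<in> T' j" "e \<notin> cl (T' i)" "col e \<in> G" for T' i j e
    using exploration_step[OF ex that(1-4)] that(5) stuck unfolding L_def G_def by blast
  have untouched: "card (A j - X) \<le> m" if j: "j < t" "j \<notin> J" for j
  proof (rule bound[OF _ j(1) T])
    show "A j - X \<subseteq> T j" by (auto simp: A_def)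
    fix e assume e: "e \<in> A j - X"
    then obtain T' i where p: "(T', i) \<in> \<C>" "e \<notin> cl (T' i)"
      by (auto simp: A_def L_def common_flat_def)
    then show "L \<subseteq> cl (T j - {e})" using cover[OF p(1) j(1)] T'(5)[OF p(1) j(2)] e by (simp add: A_def)
  qed
  have touched: "card (A j - X) \<le> k * m" if j: "j < t" for j
  proof -
    define D where "D = (\<lambda>(T', i). {e \<in> T' j. e \<notin> cl (T' i) \<and> col e \<in> G})"
    have D: "card (D p) \<le> m \<and> finite (D p)" if p: "p \<in> \<C>" for p
    proof -
      obtain T' i where pp: "p = (T', i)" by fastforce
      have v: "valid T'" using T'(1) p pp by (auto simp: optimal_def)
      then have "finite (T' j)" using j by (auto simp: valid_def intro: finite_indep)
      then show ?thesis
        using bound[of "D p" T' j] cover[of T' i j] v j p pp by (auto simp: D_def)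
    qed
    have "A j - X \<subseteq> (\<Union>p\<in>\<C>. D p)"
    proof
      fix e assume e: "e \<in> A j - X"
      then obtain T' i where p: "(T', i) \<in> \<C>" "e \<notin> cl (T' i)"
        by (auto simp: A_def L_def common_flat_def)
      have "e \<in> T' j" using T'(4)[OF p(1) j] e by (auto simp: A_def)
      then show "e \<in> (\<Union>p\<in>\<C>. D p)" using e p by (auto simp: A_def D_def)
    qed
    then have "card (A j - X) \<le> card (\<Union>p\<in>\<C>. D p)" using D fins by (intro card_mono) auto
    also have "\<dots> \<le> (\<Sum>p\<in>\<C>. card (D p))" by (rule card_UN_le[OF fins(1)])
    also have "\<dots> \<le> (\<Sum>p\<in>\<C>. m)" using D by (intro sum_mono) auto
    also have "\<dots> \<le> k * m" using fins by simp
    finally show ?thesis .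
  qed
  have upper: "(\<Sum>j<t. card (A j - X)) \<le> t * m + k * (k * m)"
  proof -
    have "(\<Sum>j<t. card (A j - X)) \<le> (\<Sum>j<t. m + (if j \<in> J then k * m else 0))"
      by (intro sum_mono) (use untouched touched in \<open>auto simp: trans_le_add2\<close>)
    also have "\<dots> = t * m + (\<Sum>j\<in>{..<t} \<inter> J. k * m)"
      by (simp add: sum.distrib flip: sum.inter_restrict)
    also have "(\<Sum>j\<in>{..<t} \<inter> J. k * m) \<le> k * (k * m)"
      using card_mono[of J "{..<t} \<inter> J"] fins by simp
    finally show ?thesis by simp
  qed
  have lower: "card G * m \<le> 3 * k + (\<Sum>j<t. card (A j - X))"
  proof -
    have Gsub: "G \<subseteq> {1..n}" by (auto simp: G_def vacatable_def)
    have per: "m \<le> card {e \<in> U - L. col e = d}" if d: "d \<in> G" for d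
    proof -
      let ?B = "{e \<in> U. col e = d}"
      have dn: "d \<in> {1..n}" using d Gsub by auto
      have "card (?B \<inter> L) \<le> set_rank L"
        using colour_indep[OF dn] by (intro card_le_set_rank) (auto intro: indep_mono)
      moreover have "{e \<in> U - L. col e = d} = ?B - L" by auto
      moreover have "card (?B - L) + card (?B \<inter> L) = n"
        using colour_card[OF dn] card_Int_Diff[of ?B L] finite_U by simp
      ultimately show ?thesis by (simp add: m_def)
    qed
    have "card G * m \<le> card {e \<in> U - L. col e \<in> G}"
      by (rule card_colours_ge[OF Gsub _ per]) auto
    also have "\<dots> \<le> card ((Y \<union> X) \<union> (\<Union>j<t. A j - X))"
    proof (rule card_mono)
      show "finite ((Y \<union> X) \<union> (\<Union>j<t. A j - X))" using fins finT by (auto simp: A_def)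
      show "{e \<in> U - L. col e \<in> G} \<subseteq> (Y \<union> X) \<union> (\<Union>j<t. A j - X)"
        using free_in_common_flat[OF ex] by (auto simp: L_def G_def A_def free_def)
    qed
    also have "\<dots> \<le> card (Y \<union> X) + card (\<Union>j<t. A j - X)" by (rule card_Un_le)
    also have "\<dots> \<le> (card Y + card X) + (\<Sum>j<t. card (A j - X))"
      by (intro add_mono card_Un_le card_UN_le) simp
    finally show ?thesis using fins by simp
  qed
  \<comment> \<open>The factor \<open>m \<ge> k\<close> absorbs the additive error \<open>3 * k\<close> and can then be cancelled.\<close>
  have km: "k \<le> m" using fins by (simp add: m_def)
  have "n * m \<le> (card G + k * (b - 1)) * m"
    using card_vacatable[OF ex] by (simp add: G_def)
  also have "\<dots> \<le> 3 * m + (t * m + k * (k * m)) + k * (b - 1) * m"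
    using lower upper km by (simp add: algebra_simps)
  also have "\<dots> = (3 + t + k * k + k * (b - 1)) * m" by (simp add: algebra_simps)
  finally have "n \<le> 3 + t + k * k + k * (b - 1)" using km k by simp
  moreover have "k * k \<le> b * b" using k by (intro mult_mono) auto
  moreover have "k * (b - 1) \<le> b * (b - 1)" using k by (intro mult_mono) auto
  moreover have "b * (b - 1) < b * b" using b_pos by simp
  moreover have "t + 2 * (b * b) + 3 \<le> n" using t_bound by (simp add: power2_eq_square)
  ultimately show False by linarith
qed

text \<open>The common flat has rank less than \<open>n - b\<close>, yet it contains at least \<open>n - b\<close> free elements, and
  any \<open>n - b\<close> elements are independent.\<close>
lemma no_long_exploration:
  assumes ex: "exploration T (Suc b) \<C> X Y J" and T: "valid T"
  shows False
proof -
  define L where "L = common_flat \<C>"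
  define G where "G = vacatable \<C>"
  have Gsub: "G \<subseteq> {1..n}" by (auto simp: G_def vacatable_def)
  have fins: "finite Y" "card Y \<le> Suc b" "set_rank L + Suc b \<le> n"
    using ex by (auto simp: exploration_def L_def)
  have fU: "free T \<subseteq> U" by (auto simp: free_def)
  have finF: "finite {e \<in> free T. col e \<in> G}" using fU finite_U by (auto intro: finite_subset)
  have "card G * (n - t) \<le> card {e \<in> free T. col e \<in> G}"
    using card_free_colour[OF T] Gsub by (intro card_colours_ge[OF Gsub fU]) fastforce
  also have "\<dots> \<le> card ({e \<in> free T. col e \<in> G} - Y) + card Y"
    using diff_card_le_card_Diff[OF fins(1), of "{e \<in> free T. col e \<in> G}"] by simp
  finally have many: "card G * (n - t) \<le> card ({e \<in> free T. col e \<in> G} - Y) + Suc b" using fins by simp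
  have "b * b = b + b * (b - 1)" using b_pos by (cases b) auto
  then have "Suc b * (b - 1) < b * b" using b_pos by (simp add: algebra_simps)
  then have G: "n \<le> card G + b * b" using card_vacatable[OF ex] by (simp add: G_def)
  \<comment> \<open>Three free elements of each colour in \<open>G\<close> are enough.\<close>
  have "3 \<le> n - t" using t_bound by linarith
  then have "3 * card G \<le> card G * (n - t)" by (simp add: mult.commute)
  then have "3 * card G \<le> card ({e \<in> free T. col e \<in> G} - Y) + Suc b" using many by linarith
  then have "n - b \<le> card ({e \<in> free T. col e \<in> G} - Y)"
    using G t_bound by (simp add: power2_eq_square)
  then obtain I where I: "I \<subseteq> {e \<in> free T. col e \<in> G} - Y" "card I = n - b"
    by (meson obtain_subset_with_card_n)
  have "b \<le> n" using fins by simp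
  then have "indep I" using I fU U_subset by (intro small_indep) auto
  moreover have "I \<subseteq> L" using I free_in_common_flat[OF ex] by (auto simp: L_def G_def)
  ultimately have "n - b \<le> set_rank L" using card_le_set_rank I by metis
  then show False using fins by simp
qed

lemma optimal_full:
  assumes opt: "optimal T" and i: "i < t"
  shows "card (T i) = n"
proof (rule ccontr)
  assume ne: "card (T i) \<noteq> n"
  have T: "valid T" and ind: "indep (T i)" using opt i by (auto simp: optimal_def valid_def)
  have less: "card (T i) < n" using ne card_indep_le[OF ind] by simp
  have "set_rank (cl (T i)) \<le> card (T i)" using set_rank_cl_le[OF ind] by simp
  then have start: "exploration T 1 {(T, i)} {} {} {i}"
    using opt i less by (simp add: exploration_def common_flat_def reached_def)
  have "\<exists>\<C> X Y J. exploration T (Suc k) \<C> X Y J" if "k \<le> b" for k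
    using that
  proof (induction k)
    case 0
    then show ?case using start by auto
  next
    case (Suc k)
    then show ?case using exploration_extends[of T "Suc k"] T by auto
  qed
  then show False using no_long_exploration T by blast
qed

theorem exists_full_family:
  "\<exists>T. disjoint_family_on T {..<t} \<and>
     (\<forall>j<t. T j \<subseteq> U \<and> indep (T j) \<and> inj_on col (T j) \<and> card (T j) = n)"
  using exists_optimal optimal_full by (metis optimal_def valid_def)

end

section \<open>Disjoint rainbow bases\<close>

text \<open>A rainbow independent set of size \<open>n\<close> meets each of the \<open>n\<close> colours exactly once; inverting the
  colouring on it gives the representatives.\<close>
theorem (in matroid) disjoint_rainbow_bases_exist:
  assumes B: "disjoint_base_sequence B" and girth: "girth + enat b \<ge> enat rank + 1"
    and b: "b \<ge> 1" and t: "t + 2 * b\<^sup>2 + 3 \<le> rank"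
  shows "\<exists>R. disjoint_rainbow_bases B R \<and> card R = t"
proof -
  define U where "U = (\<Union>c\<in>{1..rank}. B c)"
  define col where "col e = (THE c. c \<in> {1..rank} \<and> e \<in> B c)" for e
  have base: "base (B c)" if "c \<in> {1..rank}" for c
    using B that by (auto simp: disjoint_base_sequence_def base_sequence_def)
  have uniq: "c = d" if "c \<in> {1..rank}" "d \<in> {1..rank}" "e \<in> B c" "e \<in> B d" for c d e
    using B that disjoint_family_onD[of B "{1..rank}" c d]
    by (auto simp: disjoint_base_sequence_def)
  have col_eq: "col e = c" if "c \<in> {1..rank}" "e \<in> B c" for c e
    unfolding col_def by (rule the_equality) (use that uniq in blast)+
  have colour: "{e \<in> U. col e = c} = B c" if "c \<in> {1..rank}" for c
    using that col_eq by (auto simp: U_def)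
  interpret coloured_matroid E indep rank b t U col
  proof unfold_locales
    show "U \<subseteq> E" using base indep_subset_ground by (fastforce simp: U_def base_def)
    show "col e \<in> {1..rank}" if "e \<in> U" for e
      using that col_eq by (force simp: U_def)
    show "indep {e \<in> U. col e = c}" "card {e \<in> U. col e = c} = rank" if "c \<in> {1..rank}" for c
      using base[OF that] colour[OF that] base_iff_card_rank by auto
    show "indep X" if X: "X \<subseteq> E" "card X + b \<le> rank" for X
    proof (rule indep_if_card_less_girth[OF X(1)])
      show "enat (card X) < girth"
        using girth X by (cases girth) (auto simp: one_enat_def)
    qed
  qed (use card_le_rank b t in auto)
  obtain T where disj: "disjoint_family_on T {..<t}"
    and T: "\<And>j. j < t \<Longrightarrow> T j \<subseteq> U \<and> indep (T j) \<and> inj_on col (T j) \<and> card (T j) = rank"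
    using exists_full_family by blast
  define r where "r j = restrict (inv_into (T j) col) {1..rank}" for j
  have img: "col ` T j = {1..rank}" if "j < t" for j
  proof (rule card_subset_eq)
    show "col ` T j \<subseteq> {1..rank}" using T[OF that] col_range by blast
    show "card (col ` T j) = card {1..rank}" using T[OF that] by (simp add: card_image)
  qed simp
  have rT: "r j c \<in> T j" "col (r j c) = c" if "j < t" "c \<in> {1..rank}" for j c
    using that img inv_into_into[of c col "T j"] f_inv_into_f[of c col "T j"] by (auto simp: r_def)
  have rB: "r j c \<in> B c" if "j < t" "c \<in> {1..rank}" for j c
    using rT[OF that] T[OF that(1)] colour[OF that(2)] by blast
  have rainbow: "rainbow_base B (r j)" if j: "j < t" for j
    unfolding rainbow_base_def
  proof (intro conjI)
    show "r j \<in> (\<Pi>\<^sub>E c\<in>{1..rank}. B c)"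
      using rB[OF j] by (intro PiE_I) (auto simp: r_def)
    show inj: "inj_on (r j) {1..rank}" by (rule inj_on_inverseI[of _ col]) (use rT[OF j] in auto)
    have "r j ` {1..rank} = T j"
    proof (rule card_subset_eq)
      show "finite (T j)" using T[OF j] finite_indep by auto
      show "r j ` {1..rank} \<subseteq> T j" using rT[OF j] by auto
      show "card (r j ` {1..rank}) = card (T j)" using card_image[OF inj] T[OF j] by simp
    qed
    then show "base (r j ` {1..rank})" using T[OF j] base_iff_card_rank by simp
  qed
  have diff: "r i c \<noteq> r j c" if "i < t" "j < t" "i \<noteq> j" "c \<in> {1..rank}" for i j c
  proof -
    have "T i \<inter> T j = {}" using disj that by (auto simp: disjoint_family_on_def)
    then show ?thesis using rT(1)[of i c] rT(1)[of j c] that by auto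
  qed
  have "1 \<in> {1..rank}" using t by simp
  then have "inj_on r {..<t}" using diff by (intro inj_onI) (metis lessThan_iff)
  then have "card (r ` {..<t}) = t" by (simp add: card_image)
  moreover have "disjoint_rainbow_bases B (r ` {..<t})"
    unfolding disjoint_rainbow_bases_def using rainbow diff by blast
  ultimately show ?thesis by blast
qed

lemma (in matroid) card_le_max_disjoint_rainbow:
  assumes "base_sequence B" "disjoint_rainbow_bases B R"
  shows "card R \<le> max_disjoint_rainbow B"
  unfolding max_disjoint_rainbow_def
proof (rule Max_ge)
  have "finite (B c)" if "c \<in> {1..rank}" for c
    using assms that finite_indep by (auto simp: base_sequence_def base_def)
  then have "finite (\<Pi>\<^sub>E c\<in>{1..rank}. B c)" by (intro finite_PiE) auto
  moreover have "{R. disjoint_rainbow_bases B R} \<subseteq> Pow (\<Pi>\<^sub>E c\<in>{1..rank}. B c)"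
    by (auto simp: disjoint_rainbow_bases_def rainbow_base_def)
  ultimately show "finite (card ` {R. disjoint_rainbow_bases B R})"
    by (meson finite_Pow_iff finite_imageI finite_subset)
qed (use assms in auto)

theorem theorem1p2:
  fixes \<beta> :: "nat \<Rightarrow> nat" and E :: "'a set" and indep :: "'a set \<Rightarrow> bool"
    and n :: nat and B :: "nat \<Rightarrow> 'a set"
  assumes "\<And>k. k \<ge> 1 \<Longrightarrow> \<beta> k \<ge> 1"
    and "matroid E indep"
    and "matroid.rank indep = n"
    and "matroid.girth E indep + enat (\<beta> n) \<ge> enat n + 1"
    and "matroid.disjoint_base_sequence indep B"
    and "n \<ge> 4 * (\<beta> n)\<^sup>2 + 7 * \<beta> n + 5"
  shows "int (matroid.max_disjoint_rainbow indep B)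
           \<ge> int n - 4 * (int (\<beta> n))\<^sup>2 - 7 * int (\<beta> n) - 4"
proof -
  interpret matroid E indep by fact
  define t where "t = n - (4 * (\<beta> n)\<^sup>2 + 7 * \<beta> n + 4)"
  have "\<beta> n \<ge> 1" using assms(1)[of n] assms(6) by simp
  moreover have "t + 2 * (\<beta> n)\<^sup>2 + 3 \<le> rank" using assms(3,6) by (simp add: t_def)
  ultimately obtain R where R: "disjoint_rainbow_bases B R" "card R = t"
    using disjoint_rainbow_bases_exist[OF assms(5)] assms(3,4) by blast
  have "t \<le> max_disjoint_rainbow B"
    using card_le_max_disjoint_rainbow R assms(5) by (metis disjoint_base_sequence_def)
  moreover have "int t = int n - (4 * (int (\<beta> n))\<^sup>2 + 7 * int (\<beta> n) + 4)"
    using assms(6) by (simp add: t_def of_nat_diff)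
  ultimately show ?thesis by linarith
qed

end
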